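(* For integers $n\ge 1$ and $0\le j\le n$ let \[ S_n^{(j)}=\frac{1}{j!}\sum_{i=0}^{j}(-1)^i\binom{j}{i}(j-i)^n ,\qquad a(n,j)=\binom{n}{j}\,j!\,S_n^{(j)} \] (so $a(n,j)$ is the number of words of length $n$ over an alphabet of $n$ symbols that use exactly $j$ different symbols). Define $\varphi:[0,1]\to\mathbb R$ by $\varphi(x)=x^{-x}(1-x)^{-(1-x)}$ for $x\in(0,1)$ and $\varphi(0)=\varphi(1)=1$; let $\delta:(0,1)\to\mathbb R$ be the inverse of the function $y\mapsto \frac{1}{(1+e^{y})\ln(1+e^{-y})}$ (a bijection from $\mathbb R$ onto $(0,1)$); and define $\phi:(0,1)\to\mathbb R$ by \[ \phi(x)=\bigl(e\ln(1+e^{-\delta(x)})\bigr)^{-1}\varphi(x)\,e^{-x\delta(x)} . \] Then $\phi(x)<1$ for every $x\in(0,1)$ with $x\neq 1-1/e$, and there exist positive reals $r$ and $\Lambda$, both less than $1$, and positive constants $c$ and $C$ such that for every pair of integers $n,j$ with $1\le j\le n$: \[ a(n,j)\le C\sqrt{n}\,\Lambda^n n^n \quad\text{if } j/n\in[0,r]\cup[1-r,1], \] \[ a(n,j)\le C\,\phi(j/n)^n n^n \quad\text{if } j/n\in[r,1-r], \] \[ a(n,j)\ge (c/\sqrt{n})\,\phi(j/n)^n n^n \quad\text{if } j/n\in[r,1-r]. \]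
   Context: $S_n^{(j)}$ are the Stirling numbers of the second kind. *)

theory Defs
  imports
    "HOL-Analysis.Analysis"
    "HOL-Combinatorics.Stirling"
    "HOL-Real_Asymp.Real_Asymp"
begin

definition stirling2 :: "nat \<Rightarrow> nat \<Rightarrow> real" where
  "stirling2 n j =
     1 / fact j * (\<Sum>i=0..j. (- 1) ^ i * real (j choose i) * real (j - i) ^ n)"

definition word_count :: "nat \<Rightarrow> nat \<Rightarrow> real" where
  "word_count n j = real (n choose j) * fact j * stirling2 n j"

definition varphi :: "real \<Rightarrow> real" where
  "varphi x = (if x = 0 \<or> x = 1 then 1 else x powr (- x) * (1 - x) powr (- (1 - x)))"

definition delta_inv :: "real \<Rightarrow> real" where
  "delta_inv y = 1 / ((1 + exp y) * ln (1 + exp (- y)))"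

text \<open>Only the values on the open unit interval are meaningful; there \<open>inv\<close> is the
  genuine inverse by \<open>bij_betw_delta_inv\<close> below.\<close>

definition delta :: "real \<Rightarrow> real" where
  "delta = inv delta_inv"

definition phi :: "real \<Rightarrow> real" where
  "phi x = inverse (exp 1 * ln (1 + exp (- delta x))) * varphi x * exp (- x * delta x)"


lemma strict_mono_delta_inv: "strict_mono delta_inv"
proof (rule strict_monoI)
  fix a b :: real assume "a < b"
  let ?h = "\<lambda>y::real. (1 + exp y) * ln (1 + exp (- y))"
  have pos: "1 + exp y > 0" for y :: real by (simp add: add_pos_pos)
  have "?h a > ?h b"
  proof (rule DERIV_neg_imp_decreasing[OF \<open>a < b\<close>])
    fix y :: real
    have "(?h has_real_derivative
        exp y * ln (1 + exp (- y)) + (1 + exp y) * (- exp (- y) / (1 + exp (- y)))) (at y)"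
      by (rule derivative_eq_intros refl pos)+ (simp add: divide_inverse)
    also have "(1 + exp y) * (- exp (- y) / (1 + exp (- y))) = - 1"
      using pos[of "- y"] pos[of y] by (simp add: field_simps exp_minus)
    finally have "(?h has_real_derivative exp y * ln (1 + exp (- y)) + - 1) (at y)" .
    moreover have "exp y * ln (1 + exp (- y)) < exp y * exp (- y)"
      by (intro mult_strict_left_mono ln_add_one_self_less_self) auto
    then have "exp y * ln (1 + exp (- y)) < 1"
      by (simp add: exp_minus)
    ultimately show "\<exists>d. (?h has_real_derivative d) (at y) \<and> d < 0"
      by (intro exI[of _ "exp y * ln (1 + exp (- y)) + - 1"]) simp
  qed
  moreover have "?h b > 0" using pos[of b] by (intro mult_pos_pos ln_gt_zero) auto
  ultimately show "delta_inv a < delta_inv b"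
    unfolding delta_inv_def by (intro divide_strict_left_mono) auto
qed

lemma bij_betw_delta_inv: "bij_betw delta_inv UNIV {0<..<1}"
proof -
  have pos: "1 + exp y > 0" for y :: real by (simp add: add_pos_pos)
  have cont: "continuous_on UNIV delta_inv"
  proof -
    have "ln (1 + exp (- y)) \<noteq> 0" for y :: real
      using ln_gt_zero[of "1 + exp (- y)"] by simp
    moreover have "1 + exp y \<noteq> 0" for y :: real using pos[of y] by linarith
    ultimately show ?thesis
      unfolding delta_inv_def by (intro continuous_intros) auto
  qed
  have top: "(delta_inv \<longlongrightarrow> 1) at_top" and bot: "(delta_inv \<longlongrightarrow> 0) at_bot"
    unfolding delta_inv_def by real_asymp+
  have "delta_inv y > 0" for y
    unfolding delta_inv_def using pos[of y] by (intro divide_pos_pos mult_pos_pos ln_gt_zero) auto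
  moreover have "delta_inv y < 1" for y
  proof -
    have "delta_inv y < delta_inv (y + 1)"
      using strict_mono_delta_inv by (simp add: strict_mono_def)
    also have "delta_inv (y + 1) \<le> 1"
      by (rule tendsto_lowerbound[OF top])
        (auto intro!: eventually_mono[OF eventually_ge_at_top[of "y + 1"]]
          simp: strict_mono_less_eq[OF strict_mono_delta_inv])
    finally show ?thesis .
  qed
  moreover have "\<exists>y. delta_inv y = x" if x: "0 < x" "x < 1" for x
  proof -
    obtain b where b: "delta_inv b > x"
      using order_tendstoD(1)[OF top x(2)] by (auto simp: eventually_at_top_linorder)
    obtain a where a: "delta_inv a < x"
      using order_tendstoD(2)[OF bot x(1)] by (auto simp: eventually_at_bot_linorder)
    have "a \<le> b"
      using a b strict_mono_less[OF strict_mono_delta_inv, of a b] by linarith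
    then show ?thesis
      using IVT'[of delta_inv a x b] a b continuous_on_subset[OF cont] by auto
  qed
  ultimately show ?thesis
    using strict_mono_imp_inj_on[OF strict_mono_delta_inv]
    by (auto simp: bij_betw_def image_iff) metis
qed

lemma fact_stirling2:
  "fact j * stirling2 n j = (\<Sum>i\<le>j. (- 1) ^ i * real (j choose i) * real (j - i) ^ n)"
  by (simp add: stirling2_def atLeast0AtMost)

lemma stirling2_Suc_Suc:
  "stirling2 (Suc n) (Suc j) = real (Suc j) * stirling2 n (Suc j) + stirling2 n j"
proof -
  have absorb: "real (Suc j choose i) * real (Suc j - i) = real (Suc j) * real (j choose i)" for i
    using arg_cong[OF binomial_absorb_comp[of "Suc j" i], of real]
    by (simp only: of_nat_mult diff_Suc_1 mult.commute)
  have "(\<Sum>i\<le>Suc j. (- 1) ^ i * real (Suc j choose i) * real (Suc j - i) ^ n) =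
      real (Suc j) ^ n + (\<Sum>i\<le>j. (- 1) ^ Suc i * real (Suc j choose Suc i) * real (j - i) ^ n)"
    by (subst sum.atMost_Suc_shift) simp
  also have "\<dots> = real (Suc j) ^ n
      + (\<Sum>i\<le>j. (- 1) ^ Suc i * real (j choose Suc i) * real (j - i) ^ n)
      - (\<Sum>i\<le>j. (- 1) ^ i * real (j choose i) * real (j - i) ^ n)"
    by (simp add: sum.distrib[symmetric] sum_subtractf[symmetric] sum_negf[symmetric] algebra_simps)
  also have "real (Suc j) ^ n
      + (\<Sum>i\<le>j. (- 1) ^ Suc i * real (j choose Suc i) * real (j - i) ^ n)
      = (\<Sum>i\<le>Suc j. (- 1) ^ i * real (j choose i) * real (Suc j - i) ^ n)"
    by (subst sum.atMost_Suc_shift) simp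
  finally have 1: "(\<Sum>i\<le>Suc j. (- 1) ^ i * real (j choose i) * real (Suc j - i) ^ n)
      = fact (Suc j) * stirling2 n (Suc j) + fact j * stirling2 n j"
    unfolding fact_stirling2 by linarith
  have "fact (Suc j) * stirling2 (Suc n) (Suc j) =
      (\<Sum>i\<le>Suc j. (- 1) ^ i * (real (Suc j choose i) * real (Suc j - i)) * real (Suc j - i) ^ n)"
    unfolding fact_stirling2 by (intro sum.cong) (simp_all only: power_Suc mult_ac)
  also have "\<dots> = real (Suc j) * (\<Sum>i\<le>Suc j. (- 1) ^ i * real (j choose i) * real (Suc j - i) ^ n)"
    unfolding absorb sum_distrib_left by (intro sum.cong) (simp_all only: mult_ac)
  also have "\<dots> = fact (Suc j) * (real (Suc j) * stirling2 n (Suc j) + stirling2 n j)"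
    unfolding 1 by (simp add: algebra_simps)
  finally show ?thesis by (simp only: mult_cancel_left fact_nonzero simp_thms)
qed

lemma stirling2_eq_Stirling: "stirling2 n j = real (Stirling n j)"
proof (induction n j rule: Stirling.induct)
  case (2 k)
  then show ?case
    using choose_alternating_sum[of "Suc k", where 'a = real]
    by (simp add: stirling2_def atLeast0AtMost del: sum.atMost_Suc binomial_Suc_Suc)
next
  case (4 n k)
  then show ?case by (simp add: stirling2_Suc_Suc algebra_simps)
qed (simp_all add: stirling2_def)

end

theory Submission
  imports Defs
begin

text \<open>
  The numbers \<open>j! S(n,j) / n!\<close> are the coefficients of \<open>f(u) = (e\<^sup>u - 1)\<^sup>j\<close>, so they are at most
  \<open>f(u) / u\<^sup>n\<close> for every \<open>u > 0\<close>; the saddle point \<open>u = ln (1 + exp (- \<delta>))\<close> minimises this bound and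
  produces \<open>\<phi>\<close>, while \<open>u = 1\<close> compares \<open>\<phi>(x)\<close> with \<open>exp\<close> of minus the relative entropy of \<open>x\<close>
  with respect to \<open>1 - 1/e\<close>. For the lower bound no local limit theorem is needed: the
  coefficients are log-concave in \<open>n\<close>, so there is a \<open>u\<close> for which the weights \<open>m \<mapsto> coeff(m) u\<^sup>m\<close>
  have their mode at \<open>n\<close>. Their variance is at most \<open>3n\<close>, so by Chebyshev the mode
  carries a proportion of at least \<open>1 / (18 sqrt n)\<close> of the total mass \<open>f(u)\<close>; and \<open>f(u) / u\<^sup>n\<close> is no
  smaller than its minimum over \<open>u\<close>.
\<close>

section \<open>Log-concavity\<close>

text \<open>Rules out internal zeros of a row, so that the log-concavity inequalities can be
  divided. It starts at column 1 because column 0 vanishes for positive \<open>n\<close> while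
  column 1 does not.\<close>

lemma Stirling_Suc_eq_0: "Stirling n (Suc k) = 0 \<Longrightarrow> Stirling n (Suc (Suc k)) = 0"
proof (induction n arbitrary: k)
  case (Suc n)
  then show ?case by (cases k) auto
qed simp

lemma Stirling_pos:
  assumes "1 \<le> k" "k \<le> n"
  shows "Stirling n k > 0"
  using assms
proof (induction n arbitrary: k)
  case (Suc n)
  then obtain i where i: "k = Suc i" by (cases k) auto
  show ?case
  proof (cases "k \<le> n")
    case True
    then show ?thesis using Suc i by auto
  next
    case False
    then have "k = Suc n" using Suc.prems by simp
    then show ?thesis using Suc.IH[of n] by (cases n) auto
  qed
qed simp

text \<open>Expanding the recurrence in the next row yields mixed products. The only one not covered
  by the induction hypothesis is \<open>a * d\<close>, and \<open>a * d \<le> b * c\<close> comes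
  from multiplying two instances of that hypothesis and cancelling \<open>b * c\<close>.\<close>

lemma Stirling_log_concave: "Stirling n k * Stirling n (k + 2) \<le> Stirling n (k + 1) ^ 2"
proof (induction n arbitrary: k)
  case (Suc n)
  show ?case
  proof (cases k)
    case (Suc i)
    define a b c d where "a = Stirling n i" and "b = Stirling n (i + 1)"
      and "c = Stirling n (i + 2)" and "d = Stirling n (i + 3)"
    have ac: "a * c \<le> b ^ 2" and bd: "b * d \<le> c ^ 2"
      using Suc.IH[of i] Suc.IH[of "Suc i"]
      by (simp_all add: a_def b_def c_def d_def numeral_eq_Suc)
    have bc0: "d = 0" if "b = 0 \<or> c = 0"
      using that Stirling_Suc_eq_0[of n i] Stirling_Suc_eq_0[of n "Suc i"]
      by (auto simp: b_def c_def d_def numeral_eq_Suc)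
    have ad: "a * d \<le> b * c"
    proof (cases "b = 0 \<or> c = 0")
      case False
      have "(a * d) * (b * c) \<le> (b * c) * (b * c)"
        using mult_le_mono[OF ac bd] by (simp add: power2_eq_square mult_ac)
      then show ?thesis using False by simp
    qed (use bc0 in auto)
    have "((i + 1) * b + a) * ((i + 3) * d + c)
        = (i + 1) * (i + 3) * (b * d) + a * c + (i + 1) * (b * c) + (i + 3) * (a * d)"
      by (simp add: algebra_simps)
    also have "\<dots> \<le> (i + 1) * (i + 3) * c\<^sup>2 + b\<^sup>2 + (i + 1) * (b * c) + (i + 3) * (b * c)"
      by (intro add_mono mult_le_mono ac bd ad order_refl)
    \<comment> \<open>The \<open>b * c\<close> terms agree, and
      \<open>(i + 1) * (i + 3) = (i + 2)\<^sup>2 - 1\<close> leaves a slack of exactly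
      \<open>c\<^sup>2\<close>.\<close>
    also have "\<dots> \<le> ((i + 2) * c + b) ^ 2"
      by (simp add: algebra_simps power2_eq_square)
    finally show ?thesis
      by (simp add: Suc a_def b_def c_def d_def numeral_eq_Suc algebra_simps)
  qed simp
next
  case 0
  then show ?case by (cases k) auto
qed

text \<open>Here the number of blocks is fixed and the length varies. One use of the recurrence
  reduces the claim to a comparison of neighbouring columns in rows \<open>m\<close> and
  \<open>m + 1\<close>; a second reduces that to log-concavity within row \<open>m\<close>.\<close>

lemma Stirling_log_concave_length:
  "Stirling m j * Stirling (m + 2) j \<le> Stirling (m + 1) j ^ 2"
proof (cases j)
  case (Suc i)
  have "Stirling m j * Stirling (m + 1) i \<le> Stirling (m + 1) j * Stirling m i"
  proof (cases i)
    case (Suc h)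
    have "Stirling m j * Stirling m h \<le> Stirling m i ^ 2"
      using Stirling_log_concave[of m h] by (simp add: Suc \<open>j = Suc i\<close> mult.commute)
    then show ?thesis by (simp add: Suc \<open>j = Suc i\<close> algebra_simps power2_eq_square)
  qed simp
  then show ?thesis
    by (simp add: Suc algebra_simps power2_eq_square numeral_eq_Suc)
next
  case 0
  then show ?thesis by (cases m) auto
qed

text \<open>The coefficient of \<open>u ^ m\<close> in \<open>(exp u - 1) ^ j\<close>; its numerator
  counts the surjections from an \<open>m\<close>-set onto a \<open>j\<close>-set.\<close>

definition surj_coeff :: "nat \<Rightarrow> nat \<Rightarrow> real" where
  "surj_coeff j m = fact j * stirling2 m j / fact m"

lemma surj_coeff_nonneg: "surj_coeff j m \<ge> 0"
  by (simp add: surj_coeff_def stirling2_eq_Stirling)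

lemma surj_coeff_pos: "1 \<le> j \<Longrightarrow> j \<le> m \<Longrightarrow> surj_coeff j m > 0"
  using Stirling_pos[of j m] by (simp add: surj_coeff_def stirling2_eq_Stirling)

lemma surj_coeff_eq_0: "m < j \<Longrightarrow> surj_coeff j m = 0"
  by (simp add: surj_coeff_def stirling2_eq_Stirling)

text \<open>Both factors are log-concave in \<open>m\<close>: the Stirling numbers, and
  \<open>1 / fact m\<close>.\<close>

lemma surj_coeff_log_concave:
  "surj_coeff j m * surj_coeff j (m + 2) \<le> surj_coeff j (m + 1) ^ 2"
proof -
  have 1: "real (Stirling m j) * real (Stirling (m + 2) j) \<le> real (Stirling (m + 1) j) ^ 2"
    using Stirling_log_concave_length[of m j]
    by (metis of_nat_le_iff of_nat_mult of_nat_power)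
  have "(fact (m + 1))\<^sup>2 \<le> (fact m * fact (m + 2) :: real)"
    by (simp add: power2_eq_square algebra_simps numeral_eq_Suc)
  then have "(fact j)\<^sup>2 * (real (Stirling m j) * real (Stirling (m + 2) j)) / (fact m * fact (m + 2))
      \<le> (fact j)\<^sup>2 * real (Stirling (m + 1) j) ^ 2 / (fact (m + 1))\<^sup>2"
    by (intro frac_le mult_left_mono 1) auto
  then show ?thesis
    by (simp add: surj_coeff_def stirling2_eq_Stirling power2_eq_square mult_ac del: fact_Suc)
qed

text \<open>Drops one summand of the Stirling recurrence. It bounds the tilt \<open>u\<close> below
  by \<open>(n + 1) / j\<close>, which keeps the variance linear in \<open>n\<close>.\<close>

lemma surj_coeff_Suc_ge:
  assumes "1 \<le> j"
  \<comment> \<open>In other words, the ratio of the coefficients at \<open>n\<close> and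
    \<open>n + 1\<close> is at most \<open>(n + 1) / j\<close>.\<close>
  shows "real j * surj_coeff j n \<le> real (n + 1) * surj_coeff j (n + 1)"
proof -
  have "j * Stirling n j \<le> Stirling (n + 1) j"
    using assms by (cases j) auto
  then have "real j * real (Stirling n j) \<le> real (Stirling (n + 1) j)"
    by (metis of_nat_le_iff of_nat_mult)
  moreover have "real (n + 1) * surj_coeff j (n + 1) = fact j * real (Stirling (n + 1) j) / fact n"
    by (simp add: surj_coeff_def stirling2_eq_Stirling field_simps del: of_nat_Suc Stirling.simps)
  ultimately show ?thesis
    by (simp add: surj_coeff_def stirling2_eq_Stirling divide_right_mono mult.left_commute[of "real j"])
qed

text \<open>This \<open>u\<close> gives \<open>n\<close> and \<open>n + 1\<close> equal weight. The
  ratios of consecutive terms do not increase from \<open>j\<close> on, so the weights rise up to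
  \<open>n\<close> and do not rise afterwards.\<close>

lemma log_concave_tilt_mode:
  fixes b :: "nat \<Rightarrow> real"
  assumes zero: "\<And>m. m < j \<Longrightarrow> b m = 0" and pos: "\<And>m. j \<le> m \<Longrightarrow> b m > 0"
    and lc: "\<And>m. b m * b (m + 2) \<le> b (m + 1) ^ 2" and "j \<le> n"
  defines "u \<equiv> b n / b (n + 1)"
  shows "b m * u ^ m \<le> b n * u ^ n"
proof -
  have u: "u > 0" unfolding u_def using pos[of n] pos[of "n + 1"] \<open>j \<le> n\<close> by simp
  have nonneg: "b k \<ge> 0" for k using zero[of k] pos[of k] by (cases "k < j") auto
  have base: "b (n + 1) * u = b n" unfolding u_def using pos[of "n + 1"] \<open>j \<le> n\<close> by simp
  have up: "b (k + 1) * u \<le> b k" if "n \<le> k" for k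
    using that
  proof (induction k rule: dec_induct)
    case (step k)
    have "b k * (b (k + 2) * u) \<le> b (k + 1) ^ 2 * u"
      using mult_right_mono[OF lc[of k], of u] u by (simp add: mult_ac)
    also have "\<dots> \<le> b (k + 1) * b k"
      using mult_left_mono[OF step.IH nonneg[of "k + 1"]] by (simp add: power2_eq_square mult_ac)
    finally have "b k * (b (k + 2) * u) \<le> b k * b (k + 1)" by (simp add: mult_ac)
    then show ?case using pos[of k] step.hyps \<open>j \<le> n\<close> by simp
  qed (use base in simp)
  have down: "b k \<le> b (k + 1) * u" if "k \<le> n" for k
    using that
  proof (induction k rule: inc_induct)
    case (step k)
    show ?case
    proof (cases "k < j")
      case True
      then show ?thesis using zero nonneg u by simp
    next
      case False
      have "b k * b (k + 2) \<le> b (k + 1) * b (k + 1)"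
        using lc[of k] by (simp add: power2_eq_square)
      also have "\<dots> \<le> b (k + 1) * (b (k + 2) * u)"
        using mult_left_mono[OF step.IH nonneg[of "k + 1"]] by simp
      finally have "b k * b (k + 2) \<le> (b (k + 1) * u) * b (k + 2)" by (simp add: mult_ac)
      then show ?thesis using pos[of "k + 2"] False by simp
    qed
  qed (use base in simp)
  show ?thesis
  proof (cases "n \<le> m")
    case True
    then show ?thesis
    proof (induction m rule: dec_induct)
      case (step k)
      have "b (Suc k) * u ^ Suc k \<le> b k * u ^ k"
        using mult_right_mono[OF up[OF step.hyps(1)], of "u ^ k"] u by (simp add: mult_ac)
      then show ?case using step.IH by linarith
    qed simp
  next
    case False
    then have "m \<le> n" by simp
    then show ?thesis
    proof (induction m rule: inc_induct)
      case (step k)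
      have "b k * u ^ k \<le> b (Suc k) * u ^ Suc k"
        using mult_right_mono[OF down[of k], of "u ^ k"] u step.hyps by (simp add: mult_ac)
      then show ?case using step.IH by linarith
    qed simp
  qed
qed

section \<open>The generating function and its tilted distributions\<close>

text \<open>The binomial theorem expands \<open>(exp u - 1) ^ j\<close> into exponentials
  \<open>exp (real (j - i) * u)\<close>; the coefficients of their series add up to the alternating
  sum defining \<open>stirling2\<close>.\<close>

lemma surj_coeff_sums: "(\<lambda>m. surj_coeff j m * u ^ m) sums (exp u - 1) ^ j"
proof -
  have "(\<lambda>m. \<Sum>i\<le>j. ((- 1) ^ i * real (j choose i)) * ((real (j - i) * u) ^ m /\<^sub>R fact m)) sums
      (\<Sum>i\<le>j. ((- 1) ^ i * real (j choose i)) * exp (real (j - i) * u))"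
    by (intro sums_sum sums_mult exp_converges)
  also have "(\<lambda>m. \<Sum>i\<le>j. ((- 1) ^ i * real (j choose i)) * ((real (j - i) * u) ^ m /\<^sub>R fact m)) =
      (\<lambda>m. surj_coeff j m * u ^ m)"
    unfolding surj_coeff_def fact_stirling2
    by (simp add: sum_distrib_left sum_distrib_right sum_divide_distrib divide_inverse
        power_mult_distrib mult_ac)
  also have "(\<Sum>i\<le>j. ((- 1) ^ i * real (j choose i)) * exp (real (j - i) * u)) = (exp u - 1) ^ j"
    using binomial_ring[of "-1" "exp u" j]
    by (simp add: exp_of_nat_mult del: of_nat_diff) (simp add: mult_ac)
  finally show ?thesis .
qed

text \<open>The operator \<open>u * d/du\<close> multiplies the coefficient at \<open>m\<close> by
  \<open>m\<close>. Applied twice it gives the second moment.\<close>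

lemma moment_sums:
  fixes c :: "nat \<Rightarrow> real"
  assumes "\<And>z. (\<lambda>m. c m * z ^ m) sums f z" and "(f has_real_derivative D) (at u)"
  shows "(\<lambda>m. (real m * c m) * u ^ m) sums (u * D)"
proof -
  have "(\<lambda>m. diffs c m * u ^ m) sums D"
    by (rule termdiffs_sums_strong[of "\<bar>u\<bar> + 1", OF assms(1) assms(2)]) auto
  then have "(\<lambda>m. u * (diffs c m * u ^ m)) sums (u * D)" by (rule sums_mult)
  then have "(\<lambda>m. (real (Suc m) * c (Suc m)) * u ^ Suc m) sums (u * D)"
    by (simp add: diffs_def mult_ac)
  then show ?thesis by (subst (asm) sums_Suc_iff) simp
qed

text \<open>After division by \<open>F\<close> the weights are the law of a sum of \<open>j\<close>
  independent Poisson variables of parameter \<open>u\<close> conditioned to be positive. Each has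
  mean \<open>w\<close> and variance \<open>w * (1 + u - w)\<close>.\<close>

lemma surj_coeff_variance:
  assumes "1 \<le> j" "u > 0"
  defines "w \<equiv> u * exp u / (exp u - 1)"
  defines "F \<equiv> (exp u - 1) ^ j"
  shows "(\<lambda>m. (real m - j * w)\<^sup>2 * (surj_coeff j m * u ^ m)) sums (j * w * (1 + u - w) * F)"
proof -
  have E: "exp u - 1 > 0" using assms by simp
  have D1: "((\<lambda>z. (exp z - 1) ^ j) has_real_derivative (j * exp z * (exp z - 1) ^ (j - 1))) (at z)" for z
    by (auto intro!: derivative_eq_intros)
  have S1: "(\<lambda>m. (real m * surj_coeff j m) * z ^ m) sums (z * (j * exp z * (exp z - 1) ^ (j - 1)))" for z
    by (rule moment_sums[OF surj_coeff_sums D1])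
  have FE: "(exp u - 1) ^ (j - 1) = F / (exp u - 1)"
    unfolding F_def using E assms(1) by (cases j) auto
  \<comment> \<open>For \<open>j = 1\<close> the truncated exponent is harmless, since the factor
    \<open>j - 1\<close> vanishes.\<close>
  have FE2: "real (j - 1) * (exp u - 1) ^ (j - 1 - 1) = (j - 1) * F / (exp u - 1)\<^sup>2"
    unfolding F_def using E assms(1)
    by (cases j; cases "j - 1") (auto simp: power2_eq_square)
  have "((\<lambda>z. z * (j * exp z * (exp z - 1) ^ (j - 1))) has_real_derivative
      j * exp u * (exp u - 1) ^ (j - 1) + u * (j * exp u * (exp u - 1) ^ (j - 1)
        + j * exp u * (real (j - 1) * (exp u - 1) ^ (j - 1 - 1) * exp u))) (at u)"
    by (auto intro!: derivative_eq_intros simp: algebra_simps)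
  from moment_sums[OF S1 this]
  have S2: "(\<lambda>m. (real m * (real m * surj_coeff j m)) * u ^ m) sums
      ((j * w + j * w * u + j * (real j - 1) * w\<^sup>2) * F)"
    unfolding FE FE2 w_def divide_inverse power_inverse[symmetric] using assms(1)
    by (simp add: distrib_left distrib_right left_diff_distrib right_diff_distrib mult_ac add.assoc power2_eq_square)
  have S1': "(\<lambda>m. (real m * surj_coeff j m) * u ^ m) sums (j * w * F)"
    using S1[of u] unfolding FE w_def by (simp add: mult_ac)
  have "(\<lambda>m. (real m * (real m * surj_coeff j m)) * u ^ m
      - 2 * j * w * ((real m * surj_coeff j m) * u ^ m) + (j * w)\<^sup>2 * (surj_coeff j m * u ^ m)) sums
      ((j * w + j * w * u + j * (real j - 1) * w\<^sup>2) * F - 2 * j * w * (j * w * F) + (j * w)\<^sup>2 * F)"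
    by (intro sums_add sums_diff sums_mult S2 S1' surj_coeff_sums[of j u, folded F_def])
  then show ?thesis by (simp add: algebra_simps power2_eq_square)
qed

section \<open>Chebyshev's inequality and the weight of the mode\<close>

lemma card_nat_close_le:
  fixes \<mu> T :: real
  assumes "T \<ge> 0"
  shows "finite {m::nat. \<bar>real m - \<mu>\<bar> \<le> T}" "real (card {m::nat. \<bar>real m - \<mu>\<bar> \<le> T}) \<le> 2 * T + 1"
proof -
  let ?A = "{m::nat. \<bar>real m - \<mu>\<bar> \<le> T}"
  have sub: "int ` ?A \<subseteq> {\<lceil>\<mu> - T\<rceil>..\<lfloor>\<mu> + T\<rfloor>}"
    by (auto simp: ceiling_le_iff le_floor_iff)
  then show "finite ?A" by (meson finite_atLeastAtMost_int finite_imageD finite_subset inj_on_of_nat)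
  have "card ?A = card (int ` ?A)" by (simp add: card_image)
  also have "\<dots> \<le> nat (\<lfloor>\<mu> + T\<rfloor> - \<lceil>\<mu> - T\<rceil> + 1)" using card_mono[OF _ sub] by simp
  finally have "real (card ?A) \<le> real (nat (\<lfloor>\<mu> + T\<rfloor> - \<lceil>\<mu> - T\<rceil> + 1))" by simp
  also have "\<dots> \<le> 2 * T + 1"
    using assms by linarith
  finally show "real (card ?A) \<le> 2 * T + 1" .
qed

text \<open>Existence of some positive \<open>u\<close> suffices: \<open>cramer_le\<close> bounds
  the quotient from below for every such \<open>u\<close>, whether or not it is the saddle
  point.\<close>

lemma surj_coeff_lower:
  assumes j: "1 \<le> j" "j \<le> n"
  shows "\<exists>u>0. surj_coeff j n \<ge> (exp u - 1) ^ j / u ^ n / (18 * sqrt n)"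
proof -
  define u where "u = surj_coeff j n / surj_coeff j (n + 1)"
  have n: "n \<ge> 1" using j by simp
  have u: "u > 0" unfolding u_def using surj_coeff_pos[of j] j by simp
  have mode: "surj_coeff j m * u ^ m \<le> surj_coeff j n * u ^ n" for m
    unfolding u_def using surj_coeff_pos[of j] surj_coeff_eq_0[of _ j] surj_coeff_log_concave[of j] j
    by (intro log_concave_tilt_mode[where j = j]) auto
  have ju: "j * u \<le> n + 1"
    unfolding u_def using surj_coeff_Suc_ge[OF j(1), of n] surj_coeff_pos[of j "n + 1"] j
    by (simp add: field_simps)
  define w where "w = u * exp u / (exp u - 1)"
  define F where "F = (exp u - 1) ^ j"
  have E: "exp u - 1 > 0" using u by simp
  then have F: "F > 0" by (simp add: F_def)
  have w: "w \<ge> u" "w \<le> 1 + u"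
  proof -
    show "w \<ge> u" unfolding w_def using E u by (simp add: field_simps)
    have "1 + u \<le> exp u" by (rule exp_ge_add_one_self)
    then show "w \<le> 1 + u" unfolding w_def using E by (simp add: field_simps)
  qed
  \<comment> \<open>The factor \<open>1 + u - w\<close> lies between 0 and 1, and
    \<open>j + j * u \<le> n + (n + 1)\<close>.\<close>
  have V: "j * w * (1 + u - w) \<le> 3 * n"
  proof -
    have "j * w * (1 + u - w) \<le> j * w * 1" using w u by (intro mult_left_mono) auto
    also have "\<dots> \<le> j * (1 + u)" using w by (simp add: mult_left_mono)
    also have "\<dots> \<le> 3 * n" using ju j n by (simp add: algebra_simps)
    finally show ?thesis .
  qed
  \<comment> \<open>The variance is at most \<open>3 * n\<close>, so at most 3/16 of the mass, hence
    less than half, lies outside radius \<open>4 * sqrt n\<close>. The window holds at most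
    \<open>9 * sqrt n\<close> integers, whence the constant 18.\<close>
  define T where "T = 4 * sqrt n"
  have T: "T > 0" "T\<^sup>2 = 16 * n" using n by (auto simp: T_def power_mult_distrib)
  define A where "A = {m::nat. \<bar>real m - j * w\<bar> \<le> T}"
  have A: "finite A" "card A \<le> 2 * T + 1"
    unfolding A_def using card_nat_close_le[of T "j * w"] T by auto
  have S: "(\<lambda>m. surj_coeff j m * u ^ m - (real m - j * w)\<^sup>2 * (surj_coeff j m * u ^ m) / T\<^sup>2) sums
      (F - j * w * (1 + u - w) * F / T\<^sup>2)"
    unfolding F_def w_def
    by (intro sums_diff sums_divide surj_coeff_sums surj_coeff_variance j u)
  have S': "(\<lambda>m. if m \<in> A then surj_coeff j n * u ^ n else 0) sums (\<Sum>m\<in>A. surj_coeff j n * u ^ n)"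
    by (rule sums_If_finite_set) (rule A)
  \<comment> \<open>Chebyshev term by term: outside \<open>A\<close> the subtracted part is at least
    the weight itself, inside \<open>A\<close> the weight is at most that of the mode.\<close>
  have "F - j * w * (1 + u - w) * F / T\<^sup>2 \<le> (\<Sum>m\<in>A. surj_coeff j n * u ^ n)"
  proof (rule sums_le[OF _ S S'])
    fix m
    let ?W = "surj_coeff j m * u ^ m"
    have W: "?W \<ge> 0" using surj_coeff_nonneg u by simp
    show "?W - (real m - j * w)\<^sup>2 * ?W / T\<^sup>2 \<le> (if m \<in> A then surj_coeff j n * u ^ n else 0)"
    proof (cases "m \<in> A")
      case True
      have "0 \<le> (real m - j * w)\<^sup>2 * ?W / T\<^sup>2" using W by simp
      then show ?thesis using True mode[of m] by simp
    next
      case False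
      then have "T\<^sup>2 \<le> (real m - j * w)\<^sup>2"
        using abs_le_square_iff[of T "real m - j * w"] T(1) by (simp add: A_def)
      then have "T\<^sup>2 * ?W \<le> (real m - j * w)\<^sup>2 * ?W" using W by (rule mult_right_mono)
      then show ?thesis using False T(1) by (simp add: pos_le_divide_eq mult.commute)
    qed
  qed
  also have "\<dots> = card A * (surj_coeff j n * u ^ n)" by simp
  also have "\<dots> \<le> (9 * sqrt n) * (surj_coeff j n * u ^ n)"
  proof (rule mult_right_mono)
    have "1 \<le> sqrt n" using n by simp
    then show "card A \<le> 9 * sqrt n" using A(2) unfolding T_def by linarith
  qed (use u surj_coeff_nonneg[of j n] in simp)
  finally have 1: "F - j * w * (1 + u - w) * F / T\<^sup>2 \<le> (9 * sqrt n) * (surj_coeff j n * u ^ n)" .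
  have "j * w * (1 + u - w) * F / T\<^sup>2 \<le> (3 * n) * F / T\<^sup>2"
    using V F by (intro divide_right_mono mult_right_mono) auto
  also have "\<dots> \<le> F / 2" using T n F by (simp add: field_simps)
  finally have "F \<le> (18 * sqrt n) * (surj_coeff j n * u ^ n)" using 1 by simp
  then have "F / u ^ n / (18 * sqrt n) \<le> surj_coeff j n"
    using u n by (simp add: field_simps)
  then show ?thesis using u unfolding F_def by blast
qed

lemma surj_coeff_upper:
  assumes "u > 0"
  shows "surj_coeff j n \<le> (exp u - 1) ^ j / u ^ n"
proof -
  have "(\<Sum>m\<in>{n}. surj_coeff j m * u ^ m) \<le> (exp u - 1) ^ j"
    using assms surj_coeff_nonneg sums_unique[OF surj_coeff_sums[of j u]]
      sum_le_suminf[OF sums_summable[OF surj_coeff_sums[of j u]], of "{n}"] by simp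
  then show ?thesis using assms by (simp add: field_simps)
qed

section \<open>Factorials and binomial coefficients\<close>

text \<open>The midpoint and trapezoidal bounds for the integral of the convex function
  \<open>1 / t\<close> over \<open>[x, x + 1]\<close>. In terms of \<open>z = 1 / x\<close>, both
  differences vanish at 0 and have nonnegative derivative.\<close>

lemma ln_Suc_quotient_bounds:
  fixes x :: real
  assumes "x > 0"
  shows "2 / (2 * x + 1) \<le> ln (x + 1) - ln x"
    and "ln (x + 1) - ln x \<le> (1 / x + 1 / (x + 1)) / 2"
proof -
  let ?f = "\<lambda>z::real. ln (1 + z) - 2 * z / (2 + z)"
  let ?g = "\<lambda>z::real. (z + z / (1 + z)) / 2 - ln (1 + z)"
  have y: "1 / x > 0" using assms by simp
  have quot: "ln (x + 1) - ln x = ln (1 + 1 / x)"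
    using assms ln_div[of "x + 1" x] by (simp add: add_divide_distrib)
  have "?f 0 \<le> ?f (1 / x)"
  proof (rule DERIV_nonneg_imp_nondecreasing[where f = ?f])
    fix z :: real assume z: "0 \<le> z"
    have "(?f has_real_derivative 1 / (1 + z) - 4 / (2 + z)\<^sup>2) (at z)"
      using z by (auto intro!: derivative_eq_intros simp: power2_eq_square)
    also have "1 / (1 + z) - 4 / (2 + z)\<^sup>2 = z\<^sup>2 / ((1 + z) * (2 + z)\<^sup>2)"
      using z by (simp add: divide_simps) (simp add: algebra_simps power2_eq_square)
    finally have "(?f has_real_derivative z\<^sup>2 / ((1 + z) * (2 + z)\<^sup>2)) (at z)" .
    then show "\<exists>y. (?f has_real_derivative y) (at z) \<and> 0 \<le> y"
      using z by (intro exI[of _ "z\<^sup>2 / ((1 + z) * (2 + z)\<^sup>2)"] conjI) auto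
  qed (use y in simp)
  then show "2 / (2 * x + 1) \<le> ln (x + 1) - ln x"
    unfolding quot using assms by (simp add: field_simps)
  have "?g 0 \<le> ?g (1 / x)"
  proof (rule DERIV_nonneg_imp_nondecreasing[where f = ?g])
    fix z :: real assume z: "0 \<le> z"
    have "(?g has_real_derivative (1 + 1 / (1 + z)\<^sup>2) / 2 - 1 / (1 + z)) (at z)"
      using z by (auto intro!: derivative_eq_intros simp: power2_eq_square)
    also have "(1 + 1 / (1 + z)\<^sup>2) / 2 - 1 / (1 + z) = z\<^sup>2 / (2 * (1 + z)\<^sup>2)"
      using z by (simp add: divide_simps) (simp add: algebra_simps power2_eq_square)
    finally have "(?g has_real_derivative z\<^sup>2 / (2 * (1 + z)\<^sup>2)) (at z)" .
    then show "\<exists>y. (?g has_real_derivative y) (at z) \<and> 0 \<le> y"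
      using z by (intro exI[of _ "z\<^sup>2 / (2 * (1 + z)\<^sup>2)"] conjI) auto
  qed (use y in simp)
  then show "ln (x + 1) - ln x \<le> (1 / x + 1 / (x + 1)) / 2"
    unfolding quot using assms by (simp add: field_simps)
qed

text \<open>Both bounds are equalities at \<open>n = 1\<close>. The term \<open>1 / (4 * n)\<close>
  makes the trapezoidal error telescope in the induction.\<close>

lemma ln_fact_bounds:
  fixes n :: nat
  assumes "n \<ge> 1"
  shows "ln (fact n) \<le> (n + 1 / 2) * ln n - n + 1"
    and "(n + 1 / 2) * ln n - n + 3 / 4 + 1 / (4 * n) \<le> ln (fact n)"
proof -
  have "ln (fact n) \<le> (n + 1 / 2) * ln n - n + 1 \<and>
    (n + 1 / 2) * ln n - n + 3 / 4 + 1 / (4 * n) \<le> ln (fact n)"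
    using assms
  proof (induction n rule: nat_induct_at_least)
    case (Suc n)
    define x :: real where "x = n"
    have x: "x > 0" using Suc by (simp add: x_def)
    define d where "d = ln (x + 1) - ln x"
    have d: "1 \<le> (x + 1 / 2) * d" "(x + 1 / 2) * d \<le> 1 + 1 / (4 * x) - 1 / (4 * (x + 1))"
    proof -
      have "(x + 1 / 2) * (2 / (2 * x + 1)) \<le> (x + 1 / 2) * d"
        unfolding d_def using x ln_Suc_quotient_bounds(1)[OF x] by (intro mult_left_mono) auto
      then show "1 \<le> (x + 1 / 2) * d" using x by (simp add: field_simps)
      have "(x + 1 / 2) * d \<le> (x + 1 / 2) * ((1 / x + 1 / (x + 1)) / 2)"
        unfolding d_def using x ln_Suc_quotient_bounds(2)[OF x] by (intro mult_left_mono) auto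
      also have "\<dots> = 1 + 1 / (4 * x) - 1 / (4 * (x + 1))"
        using x by (simp add: divide_simps) (simp add: algebra_simps)
      finally show "(x + 1 / 2) * d \<le> 1 + 1 / (4 * x) - 1 / (4 * (x + 1))" .
    qed
    have lf: "ln (fact (Suc n)) = ln (x + 1) + ln (fact n :: real)"
      by (simp add: x_def ln_mult add.commute)
    have ln: "(x + 1 + 1 / 2) * ln (x + 1) = (x + 1 / 2) * ln x + (x + 1 / 2) * d + ln (x + 1)"
      by (simp add: d_def algebra_simps)
    have Sx: "real (Suc n) = x + 1" "real (4 * Suc n) = 4 * (x + 1)" "real (4 * n) = 4 * x" by (simp_all add: x_def)
    show ?case
      using Suc.IH d unfolding lf Sx ln x_def[symmetric] by linarith
  qed simp
  then show "ln (fact n) \<le> (n + 1 / 2) * ln n - n + 1"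
    and "(n + 1 / 2) * ln n - n + 3 / 4 + 1 / (4 * n) \<le> ln (fact n)" by auto
qed

lemma fact_bounds:
  fixes n :: nat
  assumes "n \<ge> 1"
  shows "fact n \<le> exp 1 * sqrt n * (n / exp 1) ^ n"
    and "sqrt n * (n / exp 1) ^ n \<le> fact n"
proof -
  have n: "real n > 0" using assms by simp
  have "ln (sqrt n * (n / exp 1) ^ n) = (n + 1 / 2) * ln n - n"
    using n by (simp add: ln_mult ln_realpow ln_div ln_sqrt algebra_simps)
  then have eq: "sqrt n * (n / exp 1) ^ n = exp ((n + 1 / 2) * ln n - n)"
    using n by (metis divide_pos_pos exp_gt_zero exp_ln mult_pos_pos real_sqrt_gt_zero zero_less_power)
  have f: "fact n = exp (ln (fact n :: real))" by simp
  have "exp (ln (fact n)) \<le> exp (1 + ((n + 1 / 2) * ln n - n))"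
    using ln_fact_bounds(1)[OF assms] by (subst exp_le_cancel_iff) simp
  then show "fact n \<le> exp 1 * sqrt n * (n / exp 1) ^ n"
    unfolding mult.assoc eq f[symmetric] exp_add .
  have "0 \<le> 1 / real (4 * n)" by simp
  then have "exp ((n + 1 / 2) * ln n - n) \<le> exp (ln (fact n))"
    using ln_fact_bounds(2)[OF assms] by (subst exp_le_cancel_iff) linarith
  then show "sqrt n * (n / exp 1) ^ n \<le> fact n"
    unfolding eq f[symmetric] .
qed

section \<open>Entropy estimates for binomial coefficients\<close>

lemma varphi_power:
  assumes "1 \<le> j" "j < n"
  shows "varphi (j / n) ^ n = real n ^ n / (real j ^ j * real (n - j) ^ (n - j))"
proof -
  have n: "real n > 0" "real j > 0" "real (n - j) > 0" using assms by auto
  have q: "1 - real j / n = real (n - j) / n" using assms by (simp add: field_simps)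
  have p: "(a powr (- (real k / n))) ^ n = inverse (a ^ k)" if "a > 0" for a :: real and k
    using that n by (simp add: powr_realpow[symmetric] powr_powr powr_minus[symmetric])
  have "varphi (j / n) ^ n = ((real j / n) powr (- (real j / n))) ^ n
      * ((real (n - j) / n) powr (- (real (n - j) / n))) ^ n"
    unfolding varphi_def q using assms by (simp add: power_mult_distrib del: of_nat_diff)
  also have "\<dots> = inverse ((real j / n) ^ j) * inverse ((real (n - j) / n) ^ (n - j))"
    using n by (subst (1 2) p) auto
  also have "\<dots> = real n ^ (j + (n - j)) / (real j ^ j * real (n - j) ^ (n - j))"
    unfolding power_add by (simp add: power_divide field_simps del: of_nat_diff)
  also have "j + (n - j) = n" using assms by simp
  finally show ?thesis .
qed

text \<open>\<open>varphi\<close> is the exponential of the binary entropy. In the quotient of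
  factorial bounds the powers of \<open>exp 1\<close> cancel and \<open>\<sigma>\<close> collects
  the square roots.\<close>

lemma binomial_entropy_bounds:
  assumes "1 \<le> j" "j < n"
  defines "\<sigma> \<equiv> sqrt (real n) / (sqrt (real j) * sqrt (real (n - j)))"
  shows "real (n choose j) \<le> exp 1 * \<sigma> * varphi (j / n) ^ n"
    and "\<sigma> * varphi (j / n) ^ n / (exp 1)\<^sup>2 \<le> real (n choose j)"
proof -
  define s where "s k = sqrt (real k) * (real k / exp 1) ^ k" for k :: nat
  have s: "s k > 0" if "k \<ge> 1" for k using that by (simp add: s_def)
  have fb: "fact k \<le> exp 1 * s k" "s k \<le> fact k" if "k \<ge> 1" for k :: nat
    using fact_bounds[OF that] by (simp_all add: s_def mult.assoc)
  have k: "n \<ge> 1" "j \<ge> 1" "n - j \<ge> 1" using assms by auto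
  have bin: "real (n choose j) = fact n / (fact j * fact (n - j))"
    using assms by (simp add: binomial_fact)
  have eq: "\<sigma> * varphi (j / n) ^ n = s n / (s j * s (n - j))"
  proof -
    have "exp 1 ^ n = exp 1 ^ j * (exp 1 ^ (n - j) :: real)"
      using assms by (simp add: power_add[symmetric])
    then show ?thesis
      unfolding \<sigma>_def varphi_power[OF assms(1,2)] s_def using k
      by (simp add: power_divide field_simps del: of_nat_diff)
  qed
  have "real (n choose j) \<le> (exp 1 * s n) / (s j * s (n - j))"
    unfolding bin by (intro frac_le mult_mono fb k mult_pos_pos s) (use s[OF k(1)] s[OF k(2)] s[OF k(3)] in auto)
  then show "real (n choose j) \<le> exp 1 * \<sigma> * varphi (j / n) ^ n"
    by (simp add: mult.assoc eq)
  have "s n / ((exp 1 * s j) * (exp 1 * s (n - j))) \<le> real (n choose j)"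
    unfolding bin by (intro frac_le mult_mono fb k mult_pos_pos s) (use s[OF k(1)] s[OF k(2)] s[OF k(3)] in auto)
  then show "\<sigma> * varphi (j / n) ^ n / (exp 1)\<^sup>2 \<le> real (n choose j)"
    by (simp add: eq power2_eq_square mult_ac)
qed

text \<open>Away from both ends \<open>\<sigma>\<close> is of order \<open>1 / sqrt n\<close>, which
  later cancels the \<open>sqrt n\<close> of the bound for \<open>fact n\<close>.\<close>

lemma binomial_le_middle:
  assumes "1 \<le> j" "j < n" "real n / 4 \<le> j" "real n / 4 \<le> real (n - j)"
  shows "real (n choose j) \<le> 4 * exp 1 / sqrt n * varphi (j / n) ^ n"
proof -
  have n: "real n > 0" using assms by simp
  have "real n / 4 = sqrt (real n / 4) * sqrt (real n / 4)" by simp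
  also have "\<dots> \<le> sqrt j * sqrt (real (n - j))"
    using assms by (intro mult_mono real_sqrt_le_mono) auto
  finally have le: "sqrt n / (sqrt j * sqrt (real (n - j))) \<le> sqrt n / (real n / 4)"
    using n by (intro divide_left_mono mult_pos_pos) (use assms in auto)
  also have "\<dots> = 4 / sqrt n" using n by (simp add: field_simps)
  finally have "exp 1 * (sqrt n / (sqrt j * sqrt (real (n - j)))) * varphi (j / n) ^ n
      \<le> exp 1 * (4 / sqrt n) * varphi (j / n) ^ n"
    by (intro mult_right_mono mult_left_mono zero_le_power) (auto simp: varphi_def)
  then show ?thesis using binomial_entropy_bounds(1)[OF assms(1,2)] by (simp add: mult_ac)
qed

lemma binomial_ge_entropy:
  assumes "1 \<le> j" "j < n"
  shows "varphi (j / n) ^ n / ((exp 1)\<^sup>2 * sqrt n) \<le> real (n choose j)"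
proof -
  have n: "real n > 0" using assms by simp
  have "sqrt j * sqrt (real (n - j)) \<le> sqrt n * sqrt n"
    using assms by (intro mult_mono) auto
  then have "1 / sqrt n \<le> sqrt n / (sqrt j * sqrt (real (n - j)))"
    using assms by (simp add: field_simps)
  then have "1 / sqrt n * (varphi (j / n) ^ n / (exp 1)\<^sup>2)
      \<le> sqrt n / (sqrt j * sqrt (real (n - j))) * (varphi (j / n) ^ n / (exp 1)\<^sup>2)"
    using n by (intro mult_right_mono) (auto simp: varphi_def)
  then show ?thesis using binomial_entropy_bounds(2)[OF assms] by (simp add: field_simps)
qed

section \<open>The saddle point\<close>

text \<open>\<open>cramer x\<close> is the infimum of \<open>(exp u - 1) powr x / u\<close> over \<open>u > 0\<close>.\<close>

definition cramer :: "real \<Rightarrow> real" where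
  "cramer x = exp (- x * delta x) / ln (1 + exp (- delta x))"

lemma phi_eq: "phi x = varphi x * cramer x / exp 1"
  by (simp add: phi_def cramer_def field_simps)

lemma cramer_pos: "cramer x > 0"
  by (auto simp: cramer_def intro!: divide_pos_pos ln_gt_zero)

lemma cramer_attained: "\<exists>u>0. cramer x = (exp u - 1) powr x / u"
proof (intro exI conjI)
  let ?u = "ln (1 + exp (- delta x))"
  show "?u > 0" by (intro ln_gt_zero) simp
  have "exp ?u - 1 = exp (- delta x)" by (simp add: add_pos_pos)
  then show "cramer x = (exp ?u - 1) powr x / ?u"
    by (simp add: cramer_def powr_def)
qed

lemma delta_inv_delta: "x \<in> {0<..<1} \<Longrightarrow> delta_inv (delta x) = x"
  unfolding delta_def using bij_betw_delta_inv by (metis bij_betw_imp_surj_on f_inv_into_f)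

text \<open>The logarithm of the right-hand side has derivative \<open>delta_inv y - x\<close> in
  the new variable \<open>y\<close>. As \<open>delta_inv\<close> increases, its zero
  \<open>delta x\<close> is the global minimum.\<close>

lemma cramer_le:
  assumes x: "x \<in> {0<..<1}" and u: "u > 0"
  shows "cramer x \<le> (exp u - 1) powr x / u"
proof -
  \<comment> \<open>The logarithm of the right-hand side after substituting \<open>u = ln (1 + exp (- y))\<close>.\<close>
  let ?G = "\<lambda>y. - x * y - ln (ln (1 + exp (- y)))"
  have L: "ln (1 + exp (- y)) > 0" for y :: real by (intro ln_gt_zero) simp
  have D: "(?G has_real_derivative delta_inv y - x) (at y)" for y
  proof -
    have p: "1 + exp y > 0" "1 + exp (- y) > 0" by (auto intro: add_pos_pos)
    have "(?G has_real_derivative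
        - x - (- exp (- y) / (1 + exp (- y))) / ln (1 + exp (- y))) (at y)"
      using L[of y] p by (auto intro!: derivative_eq_intros simp: divide_inverse)
    moreover have "exp (- y) / (1 + exp (- y)) = 1 / (1 + exp y)"
      using p by (simp add: exp_minus field_simps)
    ultimately show ?thesis by (simp add: delta_inv_def)
  qed
  have min: "?G (delta x) \<le> ?G y" for y
  proof (cases "delta x \<le> y")
    case True
    then show ?thesis
    proof (rule DERIV_nonneg_imp_nondecreasing)
      fix z assume "delta x \<le> z"
      then have "x \<le> delta_inv z"
        using delta_inv_delta[OF x] strict_mono_less_eq[OF strict_mono_delta_inv] by metis
      then show "\<exists>d. (?G has_real_derivative d) (at z) \<and> 0 \<le> d"
        using D[of z] by (intro exI conjI) auto
    qed
  next
    case False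
    then have "y \<le> delta x" by simp
    then show ?thesis
    proof (rule DERIV_nonpos_imp_nonincreasing)
      fix z assume "z \<le> delta x"
      then have "delta_inv z \<le> x"
        using delta_inv_delta[OF x] strict_mono_less_eq[OF strict_mono_delta_inv] by metis
      then show "\<exists>d. (?G has_real_derivative d) (at z) \<and> d \<le> 0"
        using D[of z] by (intro exI conjI) auto
    qed
  qed
  define y where "y = - ln (exp u - 1)"
  have e: "exp (- y) = exp u - 1" using u by (simp add: y_def)
  have "exp (?G (delta x)) \<le> exp (?G y)" using min by simp
  then show ?thesis
    unfolding exp_diff cramer_def using L[of "delta x"] u e by (simp add: powr_def y_def)
qed

lemma cramer_power:
  assumes "n > 0" "u > 0"
  shows "((exp u - 1) powr (real j / real n) / u) ^ n = (exp u - 1) ^ j / u ^ n"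
  using assms by (simp add: power_divide powr_realpow[symmetric] powr_powr)

text \<open>Gibbs' inequality: by \<open>ln y < y - 1\<close> the two logarithmic terms are below
  \<open>p - x\<close> and \<open>x - p\<close>, which cancel.\<close>

lemma exp_neg_relative_entropy_less_1:
  fixes x p :: real
  assumes "x \<in> {0<..<1}" "p \<in> {0<..<1}" "x \<noteq> p"
  shows "(p / x) powr x * ((1 - p) / (1 - x)) powr (1 - x) < 1"
proof -
  have strict: "ln y < y - 1" if "y > 0" "y \<noteq> 1" for y :: real
    using ln_le_minus_one[of y] ln_eq_minus_one[of y] that by fastforce
  have "x * ln (p / x) < x * (p / x - 1)"
    using assms by (intro mult_strict_left_mono strict) auto
  moreover have "(1 - x) * ln ((1 - p) / (1 - x)) < (1 - x) * ((1 - p) / (1 - x) - 1)"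
    using assms by (intro mult_strict_left_mono strict) auto
  moreover have "x * (p / x - 1) = p - x" "(1 - x) * ((1 - p) / (1 - x) - 1) = x - p"
    using assms by (simp_all add: divide_simps) (simp_all add: algebra_simps)?
  ultimately have "x * ln (p / x) + (1 - x) * ln ((1 - p) / (1 - x)) < 0" by linarith
  then have "exp (x * ln (p / x) + (1 - x) * ln ((1 - p) / (1 - x))) < 1" by simp
  then show ?thesis using assms unfolding exp_add by (simp add: powr_def)
qed

lemma phi_less_1:
  assumes x: "x \<in> {0<..<1}" and "x \<noteq> 1 - 1 / exp 1"
  shows "phi x < 1"
proof -
  let ?p = "1 - 1 / exp 1 :: real"
  have e: "exp 1 > (1::real)" by simp
  then have p: "?p \<in> {0<..<1}" by auto
  \<comment> \<open>At \<open>u = 1\<close> the bound becomes \<open>(exp 1 - 1) powr x / exp 1 = ?p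
    powr x * (1 - ?p) powr (1 - x)\<close>, so relative entropy appears.\<close>
  have "phi x \<le> varphi x * (exp 1 - 1) powr x / exp 1"
    unfolding phi_eq using cramer_le[OF x, of 1]
    by (intro divide_right_mono mult_left_mono) (auto simp: varphi_def)
  also have "\<dots> = (?p / x) powr x * ((1 - ?p) / (1 - x)) powr (1 - x)"
  proof -
    have 1: "(exp 1 - 1) powr x / exp 1 = ?p powr x * (1 - ?p) powr (1 - x)"
    proof -
      have "?p powr x = (exp 1 - 1) powr x / exp 1 powr x"
        using e by (subst powr_divide[symmetric]) (auto simp: field_simps)
      moreover have "(1 - ?p) powr (1 - x) = exp 1 powr x / exp 1"
        by (simp add: powr_def ln_div exp_diff)
      ultimately show ?thesis by simp
    qed
    have 2: "varphi x = 1 / (x powr x * (1 - x) powr (1 - x))"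
      using x unfolding varphi_def powr_minus by (simp add: field_simps)
    have 3: "(?p / x) powr x = ?p powr x / x powr x"
      "((1 - ?p) / (1 - x)) powr (1 - x) = (1 - ?p) powr (1 - x) / (1 - x) powr (1 - x)"
      using x p by (simp_all only: powr_divide)
    show ?thesis unfolding times_divide_eq_right[symmetric] 1 2 3 by simp
  qed
  also have "\<dots> < 1" using x p assms(2) by (intro exp_neg_relative_entropy_less_1) auto
  finally show ?thesis .
qed

section \<open>Word counts\<close>

lemma word_count_eq: "word_count n j = real (n choose j) * fact n * surj_coeff j n"
  by (simp add: word_count_def surj_coeff_def)

text \<open>A single term of the expansion of \<open>(b + (1 - b)) ^ n = 1\<close>. The free
  \<open>b\<close> can be put at the boundary of the edge range.\<close>

lemma binomial_le_inverse_powers: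
  fixes b :: real
  assumes "j \<le> n" "b \<in> {0<..<1}"
  shows "real (n choose j) \<le> 1 / (b ^ j * (1 - b) ^ (n - j))"
proof -
  have "real (n choose j) * b ^ j * (1 - b) ^ (n - j)
      \<le> (\<Sum>k\<le>n. real (n choose k) * b ^ k * (1 - b) ^ (n - k))"
    by (rule member_le_sum[where f = "\<lambda>k. real (n choose k) * b ^ k * (1 - b) ^ (n - k)"])
      (use assms in auto)
  also have "\<dots> = (b + (1 - b)) ^ n" by (rule binomial_ring[symmetric])
  finally show ?thesis using assms by (simp add: field_simps)
qed

text \<open>Replacing \<open>j\<close> by \<open>b * n\<close> raises the exponent of the base that
  is at least 1 and lowers that of the base that is at most 1.\<close>

lemma powers_le_powr_power:
  fixes \<alpha> \<beta> b :: real
  assumes "\<alpha> > 0" "\<beta> > 0" "j \<le> n"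
    and "(\<beta> \<le> 1 \<and> 1 \<le> \<alpha> \<and> real j \<le> b * n) \<or> (\<alpha> \<le> 1 \<and> 1 \<le> \<beta> \<and> b * n \<le> real j)"
  shows "\<alpha> ^ j * \<beta> ^ (n - j) \<le> (\<alpha> powr b * \<beta> powr (1 - b)) ^ n"
proof -
  have "\<alpha> powr j \<le> \<alpha> powr (b * n)" "\<beta> powr real (n - j) \<le> \<beta> powr ((1 - b) * n)"
  proof -
    consider "\<beta> \<le> 1 \<and> 1 \<le> \<alpha> \<and> real j \<le> b * n" | "\<alpha> \<le> 1 \<and> 1 \<le> \<beta> \<and> b * n \<le> real j"
      using assms(4) by blast
    then have "\<alpha> powr j \<le> \<alpha> powr (b * n) \<and> \<beta> powr real (n - j) \<le> \<beta> powr ((1 - b) * n)"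
      by cases (use assms(1-3) in \<open>auto intro: powr_mono powr_mono' simp: algebra_simps\<close>)
    then show "\<alpha> powr j \<le> \<alpha> powr (b * n)" "\<beta> powr real (n - j) \<le> \<beta> powr ((1 - b) * n)"
      by auto
  qed
  then have "\<alpha> powr j * \<beta> powr real (n - j) \<le> \<alpha> powr (b * n) * \<beta> powr ((1 - b) * n)"
    by (intro mult_mono) auto
  also have "\<dots> = (\<alpha> powr b * \<beta> powr (1 - b)) ^ n"
    using assms by (simp add: power_mult_distrib powr_powr[symmetric] powr_realpow)
  finally show ?thesis using assms by (simp add: powr_realpow del: of_nat_diff)
qed

text \<open>The exponential of minus the relative entropy of \<open>b\<close> with respect to
  \<open>1 - 1 / exp 1\<close>.\<close>

definition edge_rate :: "real \<Rightarrow> real" where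
  "edge_rate b = ((1 - 1 / exp 1) / b) powr b * ((1 / exp 1) / (1 - b)) powr (1 - b)"

lemma edge_rate_bounds:
  assumes "b \<in> {0<..<1}" "b \<noteq> 1 - 1 / exp 1"
  shows "0 < edge_rate b" "edge_rate b < 1"
proof -
  have "exp 1 > (1::real)" by simp
  then have "1 - 1 / exp 1 \<in> {0<..<1::real}" by auto
  then show "edge_rate b < 1" "0 < edge_rate b"
    using exp_neg_relative_entropy_less_1[of b "1 - 1 / exp 1"] assms by (auto simp: edge_rate_def)
qed

text \<open>A Chernoff-type bound: \<open>u = 1\<close> in the coefficient bound leaves a product
  monotone in \<open>j\<close> on this side of \<open>1 - 1 / exp 1\<close>, at most its value at
  \<open>j = b * n\<close>. It also covers \<open>j = n\<close>.\<close>

lemma word_count_edge: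
  assumes j: "1 \<le> j" "j \<le> n" and b: "b \<in> {0<..<1}"
    and edge: "(b \<le> 1 - 1 / exp 1 \<and> real j \<le> b * n) \<or> (1 - 1 / exp 1 \<le> b \<and> b * n \<le> real j)"
  shows "word_count n j \<le> exp 1 * sqrt n * edge_rate b ^ n * real n ^ n"
proof -
  have n: "n \<ge> 1" using j by simp
  define p q :: real where "p = 1 - 1 / exp 1" and "q = 1 / exp 1"
  have pq: "p > 0" "q > 0" "q = 1 - p" by (simp_all add: p_def q_def)
  have "word_count n j \<le> 1 / (b ^ j * (1 - b) ^ (n - j)) * (exp 1 * sqrt n * (n / exp 1) ^ n)
      * ((exp 1 - 1) ^ j / 1 ^ n)"
    unfolding word_count_eq using b
    by (intro mult_mono binomial_le_inverse_powers fact_bounds(1) n surj_coeff_upper j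
        surj_coeff_nonneg mult_nonneg_nonneg) auto
  also have "\<dots> = exp 1 * sqrt n * ((p / b) ^ j * (q / (1 - b)) ^ (n - j)) * real n ^ n"
  proof -
    have "exp 1 ^ n = exp 1 ^ j * (exp 1 ^ (n - j) :: real)"
      using j by (simp add: power_add[symmetric])
    moreover have "p = (exp 1 - 1) / exp 1" by (simp add: p_def field_simps)
    ultimately show ?thesis by (simp add: q_def power_divide power_mult_distrib mult_ac)
  qed
  also have "\<dots> \<le> exp 1 * sqrt n * edge_rate b ^ n * real n ^ n"
  proof -
    have rate: "edge_rate b = (p / b) powr b * (q / (1 - b)) powr (1 - b)"
      by (simp add: edge_rate_def p_def q_def)
    have "(q / (1 - b) \<le> 1 \<and> 1 \<le> p / b \<and> real j \<le> b * n) \<or>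
        (p / b \<le> 1 \<and> 1 \<le> q / (1 - b) \<and> b * n \<le> real j)"
      using edge b pq(3) unfolding p_def[symmetric] by (auto simp: field_simps)
    then have "(p / b) ^ j * (q / (1 - b)) ^ (n - j) \<le> edge_rate b ^ n"
      unfolding rate using pq b j by (intro powers_le_powr_power) auto
    then show ?thesis by (intro mult_right_mono mult_left_mono) auto
  qed
  finally show ?thesis .
qed

lemma word_count_upper:
  assumes "1 \<le> j" "j < n" "real n / 4 \<le> j" "real n / 4 \<le> real (n - j)"
  shows "word_count n j \<le> 4 * (exp 1)\<^sup>2 * phi (j / n) ^ n * real n ^ n"
proof -
  have n: "n \<ge> 1" using assms by simp
  obtain u where u: "u > 0" "cramer (j / n) = (exp u - 1) powr (j / n) / u"
    using cramer_attained by blast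
  have "cramer (j / n) ^ n = (exp u - 1) ^ j / u ^ n"
    unfolding u(2) using cramer_power u n by simp
  then have s: "surj_coeff j n \<le> cramer (j / n) ^ n"
    using surj_coeff_upper[OF u(1)] by simp
  \<comment> \<open>The \<open>sqrt n\<close> from the factorial cancels the
    \<open>1 / sqrt n\<close> from the binomial coefficient.\<close>
  have "word_count n j \<le> (4 * exp 1 / sqrt n * varphi (j / n) ^ n)
      * (exp 1 * sqrt n * (n / exp 1) ^ n) * cramer (j / n) ^ n"
    unfolding word_count_eq
    by (intro mult_mono binomial_le_middle fact_bounds(1) n s assms
        surj_coeff_nonneg mult_nonneg_nonneg) (auto simp: varphi_def)
  also have "\<dots> = 4 * (exp 1)\<^sup>2 * phi (j / n) ^ n * real n ^ n"
    using n by (simp add: phi_eq power_divide power_mult_distrib power2_eq_square field_simps)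
  finally show ?thesis .
qed

lemma word_count_lower:
  assumes "1 \<le> j" "j < n"
  shows "word_count n j \<ge> (1 / (18 * (exp 1)\<^sup>2)) / sqrt n * phi (j / n) ^ n * real n ^ n"
proof -
  have n: "n \<ge> 1" using assms by simp
  obtain u where u: "u > 0" "surj_coeff j n \<ge> (exp u - 1) ^ j / u ^ n / (18 * sqrt n)"
    using surj_coeff_lower[of j n] assms by auto
  have "cramer (j / n) ^ n \<le> ((exp u - 1) powr (j / n) / u) ^ n"
    using assms u(1) less_imp_le[OF cramer_pos] by (intro power_mono cramer_le) auto
  also have "\<dots> = (exp u - 1) ^ j / u ^ n" using cramer_power u n by simp
  finally have "cramer (j / n) ^ n / (18 * sqrt n) \<le> (exp u - 1) ^ j / u ^ n / (18 * sqrt n)"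
    by (intro divide_right_mono) auto
  with u(2) have s: "cramer (j / n) ^ n / (18 * sqrt n) \<le> surj_coeff j n" by linarith
  \<comment> \<open>The binomial coefficient and the surjection coefficient each lose
    \<open>sqrt n\<close>, while \<open>fact n\<close> regains one.\<close>
  have "(1 / (18 * (exp 1)\<^sup>2)) / sqrt n * phi (j / n) ^ n * real n ^ n =
      varphi (j / n) ^ n / ((exp 1)\<^sup>2 * sqrt n) * (sqrt n * (n / exp 1) ^ n)
      * (cramer (j / n) ^ n / (18 * sqrt n))"
    using n by (simp add: phi_eq power_divide power_mult_distrib power2_eq_square field_simps)
  also have "\<dots> \<le> word_count n j"
    unfolding word_count_eq
    by (intro mult_mono binomial_ge_entropy fact_bounds(2) n s assms
        surj_coeff_nonneg mult_nonneg_nonneg divide_nonneg_nonneg zero_le_power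
        less_imp_le[OF cramer_pos]) (auto simp: varphi_def)
  finally show ?thesis .
qed

theorem theorem1:
  shows "(\<forall>x\<in>{0<..<1}. x \<noteq> 1 - 1 / exp 1 \<longrightarrow> phi x < 1) \<and>
    (\<exists>r \<Lambda> c C :: real. 0 < r \<and> r < 1 \<and> 0 < \<Lambda> \<and> \<Lambda> < 1 \<and> 0 < c \<and> 0 < C \<and>
      (\<forall>n j :: nat. 1 \<le> j \<and> j \<le> n \<longrightarrow>
        (real j / real n \<in> {0..r} \<union> {1 - r..1} \<longrightarrow>
           word_count n j \<le> C * sqrt (real n) * \<Lambda> ^ n * real n ^ n) \<and>
        (real j / real n \<in> {r..1 - r} \<longrightarrow>
           word_count n j \<le> C * phi (real j / real n) ^ n * real n ^ n) \<and>
        (real j / real n \<in> {r..1 - r} \<longrightarrow>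
           word_count n j \<ge> (c / sqrt (real n)) * phi (real j / real n) ^ n * real n ^ n)))"
proof (intro conjI)
  show "\<forall>x\<in>{0<..<1}. x \<noteq> 1 - 1 / exp 1 \<longrightarrow> phi x < 1"
    using phi_less_1 by blast
  have e: "2 \<le> exp (1::real)" "exp (1::real) \<le> 3"
    using exp_ge_add_one_self[of 1] exp_le by auto
  \<comment> \<open>The maximum point \<open>1 - 1 / exp 1\<close> of the rate lies strictly inside
    the middle range, which is what permits \<open>r = 1 / 4\<close>.\<close>
  then have p: "1 / 4 < 1 - 1 / exp (1::real)" "1 - 1 / exp (1::real) < 3 / 4"
    by (auto simp: field_simps)
  define \<Lambda> where "\<Lambda> = max (edge_rate (1 / 4)) (edge_rate (3 / 4))"
  define C :: real where "C = 4 * (exp 1)\<^sup>2"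
  define c :: real where "c = 1 / (18 * (exp 1)\<^sup>2)"
  have rate: "0 < edge_rate (1 / 4)" "edge_rate (1 / 4) < 1"
    "0 < edge_rate (3 / 4)" "edge_rate (3 / 4) < 1"
    using edge_rate_bounds[of "1 / 4"] edge_rate_bounds[of "3 / 4"] p by auto
  have \<Lambda>: "0 < \<Lambda>" "\<Lambda> < 1" using rate by (auto simp: \<Lambda>_def)
  \<comment> \<open>The constant of the middle range must also dominate the factor
    \<open>exp 1\<close> of the edge bound.\<close>
  have C: "exp 1 \<le> C"
    using mult_mono[of 1 "4 * exp (1::real)" "exp 1" "exp 1"] e
    by (simp add: C_def power2_eq_square)
  have pos: "0 < c" "0 < C" by (simp_all add: c_def C_def)
  show "\<exists>r \<Lambda> c C :: real. 0 < r \<and> r < 1 \<and> 0 < \<Lambda> \<and> \<Lambda> < 1 \<and> 0 < c \<and> 0 < C \<and>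
      (\<forall>n j :: nat. 1 \<le> j \<and> j \<le> n \<longrightarrow>
        (real j / real n \<in> {0..r} \<union> {1 - r..1} \<longrightarrow>
           word_count n j \<le> C * sqrt (real n) * \<Lambda> ^ n * real n ^ n) \<and>
        (real j / real n \<in> {r..1 - r} \<longrightarrow>
           word_count n j \<le> C * phi (real j / real n) ^ n * real n ^ n) \<and>
        (real j / real n \<in> {r..1 - r} \<longrightarrow>
           word_count n j \<ge> (c / sqrt (real n)) * phi (real j / real n) ^ n * real n ^ n))"
  proof (rule exI[of _ "1 / 4"], rule exI[of _ \<Lambda>], rule exI[of _ c], rule exI[of _ C],
      intro conjI allI impI)
    fix n j :: nat
    assume "1 \<le> j \<and> j \<le> n"
    then have j: "1 \<le> j" "j \<le> n" by auto
    then have n: "real n > 0" by simp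
    {
      assume "real j / real n \<in> {0..1 / 4} \<union> {1 - 1 / 4..1}"
      then have "real j \<le> 1 / 4 * n \<or> 3 / 4 * n \<le> real j"
        using n by (auto simp: field_simps)
      then obtain b where b: "b = 1 / 4 \<or> b = 3 / 4"
        and "word_count n j \<le> exp 1 * sqrt n * edge_rate b ^ n * real n ^ n"
        using word_count_edge[OF j, of "1 / 4"] word_count_edge[OF j, of "3 / 4"] p by fastforce
      note this(2)
      also have "\<dots> \<le> C * sqrt n * \<Lambda> ^ n * real n ^ n"
      proof -
        have "0 < edge_rate b" "edge_rate b \<le> \<Lambda>" using b rate unfolding \<Lambda>_def by (elim disjE; hypsubst; simp)+
        then show ?thesis using C pos by (intro mult_right_mono mult_mono power_mono) auto
      qed
      finally show "word_count n j \<le> C * sqrt (real n) * \<Lambda> ^ n * real n ^ n" .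
    }
    assume "real j / real n \<in> {1 / 4..1 - 1 / 4}"
    then have m: "real n / 4 \<le> j" "real n / 4 \<le> real (n - j)" "j < n"
      using n j by (auto simp: field_simps)
    show "word_count n j \<le> C * phi (real j / real n) ^ n * real n ^ n"
      unfolding C_def using word_count_upper[OF j(1) m(3,1,2)] .
    show "word_count n j \<ge> (c / sqrt (real n)) * phi (real j / real n) ^ n * real n ^ n"
      unfolding c_def using word_count_lower[OF j(1) m(3)] .
  qed (use \<Lambda> pos in auto)
qed

end
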